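(* Let $\Gamma$ be a finitely generated group having the $U$-property. Then every well displacing action of $\Gamma$ by isometries on a metric space $X$ has orbit maps which are quasi-isometric embeddings.
   Context: Fix a finite generating set $S$ of $\Gamma$, with word length $\Vert\cdot\Vert$ and word metric $d_S$. The translation length is $\ell(\gamma)=\inf_{\eta\in\Gamma}\Vert\eta\gamma\eta^{-1}\Vert$. The group $\Gamma$ has the $U$-property (is undistorted in its conjugacy classes) if there exist finitely many elements $g_1,\dots,g_p\in\Gamma$ and positive constants $A,B$ such that for all $\gamma\in\Gamma$, $\Vert\gamma\Vert\leqslant A\sup_{1\leqslant i\leqslant p}\ell(g_i\gamma)+B$ (this does not depend on $S$). For an isometry $\gamma$ of a metric space $X$, the displacement is $d_X(\gamma)=\inf_{x\in X}d(x,\gamma(x))$. An action of $\Gamma$ by isometries on $X$ is well displacing if there exist positive constants $A,B$ such that $d_X(\gamma)\geqslant A\,\ell(\gamma)-B$ for all $\gamma\in\Gamma$. Orbit maps are the maps $\Gamma\to X$, $\gamma\mapsto\gamma(x)$; such a map is a quasi-isometric embedding if there are $A\geqslant 1$, $B\geqslant 0$ with $A^{-1}d_S(\gamma,\eta)-B\leqslant d(\gamma(x),\eta(x))\leqslant A\,d_S(\gamma,\eta)+B$ for all $\gamma,\eta\in\Gamma$. *)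

theory Defs
  imports
    "HOL-Analysis.Abstract_Metric_Spaces"
    "HOL-Algebra.Generated_Groups"
    "HOL-Algebra.Group_Action"
begin

section \<open>Word length, word metric and translation length\<close>

definition finite_generating_set :: "('a, 'm) monoid_scheme \<Rightarrow> 'a set \<Rightarrow> bool" where
  "finite_generating_set G S \<longleftrightarrow>
     finite S \<and> S \<subseteq> carrier G \<and> generate G S = carrier G"

text \<open>The set \<open>S\<close> need not be symmetric, so words are over \<open>S\<close> and the inverses of its elements.\<close>

definition word_length :: "('a, 'm) monoid_scheme \<Rightarrow> 'a set \<Rightarrow> 'a \<Rightarrow> nat" where
  "word_length G S g =
     (LEAST n. \<exists>ws. length ws = n \<and> set ws \<subseteq> S \<union> m_inv G ` S \<and>
                    foldr (mult G) ws \<one>\<^bsub>G\<^esub> = g)"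

text \<open>This is the left-invariant word metric, which is the one compatible with the
  left actions (and hence orbit maps) considered below.\<close>

definition word_metric :: "('a, 'm) monoid_scheme \<Rightarrow> 'a set \<Rightarrow> 'a \<Rightarrow> 'a \<Rightarrow> real" where
  "word_metric G S g h = real (word_length G S (inv\<^bsub>G\<^esub> g \<otimes>\<^bsub>G\<^esub> h))"

definition translation_length :: "('a, 'm) monoid_scheme \<Rightarrow> 'a set \<Rightarrow> 'a \<Rightarrow> real" where
  "translation_length G S g =
     (INF h\<in>carrier G. real (word_length G S (h \<otimes>\<^bsub>G\<^esub> g \<otimes>\<^bsub>G\<^esub> inv\<^bsub>G\<^esub> h)))"

text \<open>The condition \<open>p \<ge> 1\<close> avoids the supremum of the empty set, which is unspecified on \<open>real\<close>.\<close>

definition U_property :: "('a, 'm) monoid_scheme \<Rightarrow> 'a set \<Rightarrow> bool" where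
  "U_property G S \<longleftrightarrow>
     (\<exists>(p::nat) (g::nat \<Rightarrow> 'a) (A::real) (B::real).
        p \<ge> 1 \<and> (\<forall>i\<in>{1..p}. g i \<in> carrier G) \<and> A > 0 \<and> B > 0 \<and>
        (\<forall>\<gamma>\<in>carrier G.
           real (word_length G S \<gamma>)
             \<le> A * (SUP i\<in>{1..p}. translation_length G S (g i \<otimes>\<^bsub>G\<^esub> \<gamma>)) + B))"


section \<open>Isometric actions\<close>

locale isometric_action =
  group_action G X \<phi> + Metric_space X d
  for G (structure) and X and \<phi> and d +
  assumes isometry:
    "\<lbrakk>g \<in> carrier G; x \<in> X; y \<in> X\<rbrakk> \<Longrightarrow> d (\<phi> g x) (\<phi> g y) = d x y"

definition displacement :: "'b set \<Rightarrow> ('b \<Rightarrow> 'b \<Rightarrow> real) \<Rightarrow> ('b \<Rightarrow> 'b) \<Rightarrow> real" where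
  "displacement X d f = (INF x\<in>X. d x (f x))"

definition well_displacing ::
  "('a, 'm) monoid_scheme \<Rightarrow> 'a set \<Rightarrow> 'b set \<Rightarrow> ('b \<Rightarrow> 'b \<Rightarrow> real) \<Rightarrow> ('a \<Rightarrow> 'b \<Rightarrow> 'b) \<Rightarrow> bool" where
  "well_displacing G S X d \<phi> \<longleftrightarrow>
     (\<exists>A>0. \<exists>B>0. \<forall>\<gamma>\<in>carrier G.
        displacement X d (\<phi> \<gamma>) \<ge> A * translation_length G S \<gamma> - B)"

definition quasi_isometric_embedding ::
  "'a set \<Rightarrow> ('a \<Rightarrow> 'a \<Rightarrow> real) \<Rightarrow> 'b set \<Rightarrow> ('b \<Rightarrow> 'b \<Rightarrow> real) \<Rightarrow> ('a \<Rightarrow> 'b) \<Rightarrow> bool" where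
  "quasi_isometric_embedding Y dY X dX f \<longleftrightarrow>
     f \<in> Y \<rightarrow> X \<and>
     (\<exists>A\<ge>1. \<exists>B\<ge>0. \<forall>y\<in>Y. \<forall>z\<in>Y.
        inverse A * dY y z - B \<le> dX (f y) (f z) \<and> dX (f y) (f z) \<le> A * dY y z + B)"

end

(* Write D(\<gamma>) = d(x, \<gamma> x). D is subadditive and symmetric, so it is bounded above by a multiple
   of the word length. Conversely, D dominates the displacement, hence (up to constants) the
   translation length, and D(g_i \<gamma>) differs from D(\<gamma>) by at most the constant D(g_i); the
   U-property then bounds the word length of \<gamma> in terms of D(\<gamma>). *)
theory Submission
  imports Defs
begin

context group
begin

lemma foldr_mult_append:
  assumes "set us \<subseteq> carrier G" "set vs \<subseteq> carrier G"
  shows "foldr (\<otimes>) (us @ vs) \<one> = foldr (\<otimes>) us \<one> \<otimes> foldr (\<otimes>) vs \<one>"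
proof -
  have closed: "set ws \<subseteq> carrier G \<Longrightarrow> foldr (\<otimes>) ws \<one> \<in> carrier G" for ws
    by (induction ws) auto
  show ?thesis
    using assms by (induction us) (auto simp: closed m_assoc)
qed

text \<open>Induction over \<open>generate\<close>: the four introduction rules correspond to the
  empty word, a letter, an inverse letter and concatenation of words.\<close>

lemma generate_imp_word:
  assumes "S \<subseteq> carrier G" "g \<in> generate G S"
  shows "\<exists>ws. set ws \<subseteq> S \<union> m_inv G ` S \<and> foldr (\<otimes>) ws \<one> = g"
  using assms(2)
proof induction
  case one
  show ?case by (intro exI[of _ "[]"]) simp
next
  case (incl h)
  then show ?case using assms(1) by (intro exI[of _ "[h]"]) auto
next
  case (inv h)
  then show ?case using assms(1) by (intro exI[of _ "[inv h]"]) auto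
next
  case (eng h1 h2)
  then obtain us vs where
    "set us \<subseteq> S \<union> m_inv G ` S" "foldr (\<otimes>) us \<one> = h1"
    "set vs \<subseteq> S \<union> m_inv G ` S" "foldr (\<otimes>) vs \<one> = h2"
    by blast
  moreover have "S \<union> m_inv G ` S \<subseteq> carrier G"
    using assms(1) by auto
  ultimately have "set (us @ vs) \<subseteq> S \<union> m_inv G ` S"
    "foldr (\<otimes>) (us @ vs) \<one> = h1 \<otimes> h2"
    using foldr_mult_append[of us vs] by auto
  then show ?case
    by blast
qed

text \<open>A \<open>LEAST\<close> is informative only if a witness exists. Generation provides a
  word for every group element, so a shortest one realizes \<open>word_length\<close>.\<close>

lemma word_length_attained:
  assumes "finite_generating_set G S" "g \<in> carrier G"
  obtains ws where "length ws = word_length G S g"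
    "set ws \<subseteq> S \<union> m_inv G ` S" "foldr (\<otimes>) ws \<one> = g"
proof -
  have "\<exists>n ws. length ws = n \<and> set ws \<subseteq> S \<union> m_inv G ` S \<and> foldr (\<otimes>) ws \<one> = g"
    using generate_imp_word[of S g] assms unfolding finite_generating_set_def by auto
  from LeastI_ex[OF this] show ?thesis
    using that unfolding word_length_def by blast
qed

end

context isometric_action
begin

text \<open>The unit is sent to the unit of the group of bijections of \<open>X\<close>, which is
  the identity restricted to \<open>X\<close>.\<close>

lemma one_acts_trivially:
  assumes "x \<in> X"
  shows "\<phi> \<one> x = x"
  using assms by (metis id_eq_one restrict_apply')

lemma action_closed:
  assumes "g \<in> carrier G" "x \<in> X"
  shows "\<phi> g x \<in> X"
  using element_image[OF assms refl] .

text \<open>Applying the isometry \<open>\<phi> g\<close> to the pair on the right gives the pair on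
  the left. Both the orbit distance and the word metric thus depend only on
  \<open>inv g \<otimes> h\<close>, which reduces two-point estimates to one group element.\<close>

lemma orbit_distance:
  assumes "x \<in> X" "g \<in> carrier G" "h \<in> carrier G"
  shows "d (\<phi> g x) (\<phi> h x) = d x (\<phi> (inv g \<otimes> h) x)"
proof -
  interpret group G by (rule group_hom[THEN group_hom.axioms(1)])
  have "g \<otimes> (inv g \<otimes> h) = h"
    using assms by (simp flip: m_assoc)
  then have "\<phi> h x = \<phi> g (\<phi> (inv g \<otimes> h) x)"
    using composition_rule[of x g "inv g \<otimes> h"] assms by simp
  then show ?thesis
    using assms by (simp add: isometry action_closed)
qed

text \<open>This is \<open>orbit_distance\<close> for the pair \<open>g\<close>,
  \<open>\<one>\<close>. It lets inverse letters in a word be estimated like the generators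
  themselves.\<close>

lemma orbit_distance_inv:
  assumes "x \<in> X" "g \<in> carrier G"
  shows "d x (\<phi> (inv g) x) = d x (\<phi> g x)"
proof -
  interpret group G by (rule group_hom[THEN group_hom.axioms(1)])
  have "d x (\<phi> (inv g) x) = d (\<phi> g x) (\<phi> \<one> x)"
    using assms by (simp add: orbit_distance)
  then show ?thesis
    using assms by (simp add: commute one_acts_trivially)
qed

text \<open>Triangle inequality through \<open>\<phi> g x\<close>; the second leg has length
  \<open>d x (\<phi> h x)\<close> because \<open>\<phi> g\<close> is an isometry.\<close>

lemma orbit_distance_mult:
  assumes "x \<in> X" "g \<in> carrier G" "h \<in> carrier G"
  shows "d x (\<phi> (g \<otimes> h) x) \<le> d x (\<phi> g x) + d x (\<phi> h x)"
  using triangle[of x "\<phi> g x" "\<phi> g (\<phi> h x)"] assms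
  by (simp add: composition_rule isometry action_closed)

lemma orbit_distance_le_word_length:
  assumes fg: "finite_generating_set G S" and x: "x \<in> X"
  obtains M where "\<And>g. g \<in> carrier G \<Longrightarrow> d x (\<phi> g x) \<le> M * real (word_length G S g)"
proof -
  interpret group G by (rule group_hom[THEN group_hom.axioms(1)])
  \<comment> \<open>A sum of nonnegative terms bounds each of them, so it can replace the maximum
    over \<open>S\<close> and is also defined for empty \<open>S\<close>.\<close>
  define M where "M = (\<Sum>s\<in>S. d x (\<phi> s x))"
  have fin: "finite S" and sub: "S \<subseteq> carrier G"
    using fg by (auto simp: finite_generating_set_def)
  have gen: "d x (\<phi> s x) \<le> M" if "s \<in> S" for s
    unfolding M_def using fin that by (intro member_le_sum) auto
  have gen_inv: "s \<in> carrier G \<and> d x (\<phi> s x) \<le> M" if "s \<in> S \<union> m_inv G ` S" for s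
    using that gen sub x by (auto simp: orbit_distance_inv subset_iff)
  \<comment> \<open>Membership in the carrier is carried through the induction because subadditivity
    requires it for the tail of the word.\<close>
  have word: "foldr (\<otimes>) ws \<one> \<in> carrier G \<and> d x (\<phi> (foldr (\<otimes>) ws \<one>) x) \<le> M * real (length ws)"
    if "set ws \<subseteq> S \<union> m_inv G ` S" for ws
    using that
  proof (induction ws)
    case Nil
    then show ?case using x by (simp add: one_acts_trivially)
  next
    case (Cons s ws)
    then have "s \<in> carrier G" "d x (\<phi> s x) \<le> M"
      using gen_inv by auto
    then show ?case
      using Cons orbit_distance_mult[OF x, of s "foldr (\<otimes>) ws \<one>"]
      by (auto simp: algebra_simps)
  qed
  show ?thesis
  proof
    fix g assume "g \<in> carrier G"
    then obtain ws where "length ws = word_length G S g"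
      "set ws \<subseteq> S \<union> m_inv G ` S" "foldr (\<otimes>) ws \<one> = g"
      by (rule word_length_attained[OF fg])
    then show "d x (\<phi> g x) \<le> M * real (word_length G S g)"
      using word[of ws] by simp
  qed
qed

lemma displacement_le_orbit_distance:
  assumes "x \<in> X"
  shows "displacement X d (\<phi> g) \<le> d x (\<phi> g x)"
  unfolding displacement_def using assms
  by (intro cINF_lower) (auto intro: bdd_belowI[of _ 0])

text \<open>The sign of \<open>L\<close> is recorded because \<open>L\<close> becomes the additive
  constant of the embedding; \<open>K\<close> is enlarged later, so its sign is left open.\<close>

lemma word_length_le_orbit_distance:
  assumes U: "U_property G S" and wd: "well_displacing G S X d \<phi>" and x: "x \<in> X"
  obtains K L where "0 \<le> L"
    "\<And>g. g \<in> carrier G \<Longrightarrow> real (word_length G S g) \<le> K * d x (\<phi> g x) + L"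
proof -
  interpret group G by (rule group_hom[THEN group_hom.axioms(1)])
  from U obtain p :: nat and g A B where p: "p \<ge> 1" and g: "\<And>i. i \<in> {1..p} \<Longrightarrow> g i \<in> carrier G"
    and A: "A > 0" and B: "B > 0"
    and U': "\<And>\<gamma>. \<gamma> \<in> carrier G \<Longrightarrow> real (word_length G S \<gamma>)
        \<le> A * (SUP i\<in>{1..p}. translation_length G S (g i \<otimes> \<gamma>)) + B"
    unfolding U_property_def by blast
  from wd obtain a b where a: "a > 0" and b: "b > 0"
    and wd': "\<And>\<gamma>. \<gamma> \<in> carrier G \<Longrightarrow> displacement X d (\<phi> \<gamma>) \<ge> a * translation_length G S \<gamma> - b"
    unfolding well_displacing_def by blast
  \<comment> \<open>One constant dominating the orbit distances of all the finitely many
    \<open>g i\<close>.\<close>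
  define C where "C = (\<Sum>i\<in>{1..p}. d x (\<phi> (g i) x))"
  have C: "C \<ge> 0"
    unfolding C_def by (intro sum_nonneg) auto
  show ?thesis
  proof
    show "0 \<le> A * (C + b) / a + B"
      using A B C a b by simp
  next
    fix \<gamma> assume \<gamma>: "\<gamma> \<in> carrier G"
    \<comment> \<open>The bound does not depend on \<open>i\<close>, so it passes to the
      supremum.\<close>
    have "translation_length G S (g i \<otimes> \<gamma>) \<le> (d x (\<phi> \<gamma> x) + C + b) / a" if i: "i \<in> {1..p}" for i
    proof -
      have "a * translation_length G S (g i \<otimes> \<gamma>) - b \<le> d x (\<phi> (g i \<otimes> \<gamma>) x)"
        using wd'[of "g i \<otimes> \<gamma>"] displacement_le_orbit_distance[OF x, of "g i \<otimes> \<gamma>"] g[OF i] \<gamma>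
        by auto
      also have "\<dots> \<le> d x (\<phi> (g i) x) + d x (\<phi> \<gamma> x)"
        by (rule orbit_distance_mult[OF x g[OF i] \<gamma>])
      also have "d x (\<phi> (g i) x) \<le> C"
        unfolding C_def using i by (intro member_le_sum) auto
      finally show ?thesis
        using a by (simp add: field_simps)
    qed
    \<comment> \<open>Here \<open>p \<ge> 1\<close> makes the index set nonempty, as a least upper
      bound on the reals requires.\<close>
    then have "(SUP i\<in>{1..p}. translation_length G S (g i \<otimes> \<gamma>)) \<le> (d x (\<phi> \<gamma> x) + C + b) / a"
      using p by (intro cSUP_least) auto
    then have "A * (SUP i\<in>{1..p}. translation_length G S (g i \<otimes> \<gamma>))
        \<le> A * ((d x (\<phi> \<gamma> x) + C + b) / a)"
      using A by (intro mult_left_mono) auto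
    also have "\<dots> = A / a * d x (\<phi> \<gamma> x) + A * (C + b) / a"
      by (simp add: field_simps add_divide_distrib)
    finally show "real (word_length G S \<gamma>) \<le> A / a * d x (\<phi> \<gamma> x) + (A * (C + b) / a + B)"
      using U'[OF \<gamma>] by linarith
  qed
qed

end

theorem lemma4p0p4:
  fixes G :: "('a, 'm) monoid_scheme"
    and S :: "'a set"
    and X :: "'b set"
    and d :: "'b \<Rightarrow> 'b \<Rightarrow> real"
    and \<phi> :: "'a \<Rightarrow> 'b \<Rightarrow> 'b"
  assumes "group G"
    and "finite_generating_set G S"
    and "U_property G S"
    and "isometric_action G X \<phi> d"
    and "well_displacing G S X d \<phi>"
  shows "\<forall>x\<in>X. quasi_isometric_embedding (carrier G) (word_metric G S) X d (\<lambda>\<gamma>. \<phi> \<gamma> x)"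
proof
  fix x assume x: "x \<in> X"
  interpret group G by fact
  interpret isometric_action G X \<phi> d by fact
  obtain M where M: "\<And>g. g \<in> carrier G \<Longrightarrow> d x (\<phi> g x) \<le> M * real (word_length G S g)"
    using orbit_distance_le_word_length[OF assms(2) x] by blast
  obtain K L where L: "0 \<le> L" and
    K: "\<And>g. g \<in> carrier G \<Longrightarrow> real (word_length G S g) \<le> K * d x (\<phi> g x) + L"
    using word_length_le_orbit_distance[OF assms(3,5) x] by blast
  \<comment> \<open>A single multiplicative constant serves both inequalities: enlarging
    \<open>M\<close> or \<open>K\<close> is harmless since distances and word lengths are
    nonnegative.\<close>
  define A where "A = max 1 (max M K)"
  have A: "A \<ge> 1" "M \<le> A" "K \<le> A"
    by (auto simp: A_def)
  have bounds: "inverse A * word_metric G S g h - L \<le> d (\<phi> g x) (\<phi> h x) \<and>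
      d (\<phi> g x) (\<phi> h x) \<le> A * word_metric G S g h + L"
    if "g \<in> carrier G" "h \<in> carrier G" for g h
  proof -
    define k where "k = inv\<^bsub>G\<^esub> g \<otimes>\<^bsub>G\<^esub> h"
    have k: "k \<in> carrier G"
      using that by (simp add: k_def)
    have "real (word_length G S k) \<le> A * d x (\<phi> k x) + L"
      using K[OF k] mult_right_mono[OF A(3) nonneg[of x "\<phi> k x"]] by linarith
    \<comment> \<open>Since \<open>A \<ge> 1\<close> and \<open>L \<ge> 0\<close>, \<open>L\<close>
      is at most \<open>A * L\<close>; after division by \<open>A\<close> the additive error is
      still at most \<open>L\<close>.\<close>
    also have "\<dots> \<le> A * (d x (\<phi> k x) + L)"
      using mult_right_mono[OF A(1) L] by (simp add: algebra_simps)
    finally have "inverse A * real (word_length G S k) - L \<le> d x (\<phi> k x)"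
      using A(1) by (simp add: field_simps)
    moreover have "d x (\<phi> k x) \<le> A * real (word_length G S k) + L"
      using M[OF k] mult_right_mono[OF A(2), of "real (word_length G S k)"] L by simp
    ultimately show ?thesis
      using that x by (simp add: orbit_distance word_metric_def k_def)
  qed
  have "(\<lambda>\<gamma>. \<phi> \<gamma> x) \<in> carrier G \<rightarrow> X"
    using x action_closed by auto
  then show "quasi_isometric_embedding (carrier G) (word_metric G S) X d (\<lambda>\<gamma>. \<phi> \<gamma> x)"
    unfolding quasi_isometric_embedding_def using bounds A(1) L by blast
qed

end
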